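(* Let $\mathbb X=\{X_Q\}_{Q\subset\mathbb R^n}$ be a normalized family of quasi-Banach function spaces, with normalization constants $0<c_0\le C_0<\infty$, that is, $c_0\le\|\chi_Q\|_{X_Q}\le C_0$ for every cube $Q$. Suppose that there exists $0<\lambda<1/2$ such that $\Lambda_{\mathbb X}(\lambda)>0$. Then $$BMO_{\mathbb X}^{*}\cap L^1_{\mathrm{loc}}(\mathbb R^n)\hookrightarrow BMO.$$ More precisely, for every $f\in BMO_{\mathbb X}^{*}\cap L^1_{\mathrm{loc}}(\mathbb R^n)$, $$\|f\|_{BMO}\le\frac{C_{n,\lambda}}{c_0\,\Lambda_{\mathbb X}(\lambda)}\,\|f\|_{BMO_{\mathbb X}^{*}},$$ where $C_{n,\lambda}$ is the constant in the John--Str\"omberg inequality $\|f\|_{BMO}\le C_{n,\lambda}\|f\|_{BMO^\#_\lambda}$.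
   Context: Cubes in $\mathbb R^n$ have sides parallel to the coordinate axes; $|E|$ is Lebesgue measure, $\chi_E$ the characteristic function; functions are real-valued and measurable; $\langle f\rangle_Q=\frac1{|Q|}\int_Q f$. A quasi-Banach function space over a measure space $\Omega$ is a quasi-normed lattice $X\subset L^0(\Omega)$ such that: (1) if $|f|\le|g|$ a.e. and $g\in X$, then $f\in X$ and $\|f\|_X\le\|g\|_X$; (2) $\|f+g\|_X\le C_X(\|f\|_X+\|g\|_X)$ for some $C_X\ge1$; (3) (Fatou) if $0\le f_j\uparrow f$ a.e. and $\sup_j\|f_j\|_X<\infty$, then $f\in X$ and $\|f\|_X=\sup_j\|f_j\|_X$. Here, for each cube $Q$, $X_Q$ is a quasi-Banach function space over $(Q,dx)$; $\|g\chi_Q\|_{X_Q}$ denotes the $X_Q$-quasi-norm of the restriction of $g$ to $Q$ (with value $+\infty$ if this restriction is not in $X_Q$). For $0<t<1$, $$\Lambda_{\mathbb X}(t):=\inf_Q\inf_{E\subset Q,\ |E|\ge t|Q|}\frac{\|\chi_E\|_{X_Q}}{\|\chi_Q\|_{X_Q}}$$ (infimum over all cubes $Q$ and measurable $E\subset Q$). Best-constant seminorm: $\|f\|_{BMO_{\mathbb X}^{*}}:=\sup_Q\inf_{c\in\mathbb R}\|(f-c)\chi_Q\|_{X_Q}$, and $BMO_{\mathbb X}^*$ consists of the measurable $f$ for which this is finite. Classical seminorm: $\|f\|_{BMO}:=\sup_Q\frac1{|Q|}\int_Q|f-\langle f\rangle_Q|\,dx$ for $f\in L^1_{\mathrm{loc}}(\mathbb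 R^n)$. For $g$ measurable on $Q$, $g_Q^*(t):=\inf\{\alpha>0:|\{x\in Q:|g(x)|>\alpha\}|\le t\}$, $0<t<|Q|$. Set $\omega_\lambda(f;Q):=\inf_{c\in\mathbb R}((f-c)\chi_Q)_Q^*(\lambda|Q|)$ and $\|f\|_{BMO_\lambda^\#}:=\sup_Q\omega_\lambda(f;Q)$. The John--Str\"omberg theorem (known) says that for $0<\lambda<1/2$ there is a constant $C_{n,\lambda}>0$ depending only on $n,\lambda$ with $\|f\|_{BMO}\le C_{n,\lambda}\|f\|_{BMO^\#_\lambda}$ for all $f\in L^1_{\mathrm{loc}}(\mathbb R^n)$; $C_{n,\lambda}$ denotes such a constant. $A\hookrightarrow B$ means $A$ is continuously embedded in $B$ (inclusion with the seminorm of $B$ bounded by a constant times that of $A$); $BMO_{\mathbb X}^{*}\cap L^1_{\mathrm{loc}}$ carries the seminorm $\|\cdot\|_{BMO_{\mathbb X}^*}$. *)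

theory Defs
  imports "HOL-Analysis.Analysis"
begin

text \<open>Closed cubes; the boundary is a null set, so the choice is immaterial.\<close>

definition cubes :: "(real ^ 'n) set set" where
  "cubes = {Q. \<exists>a s. 0 < s \<and> Q = cbox a (\<chi> i. a $ i + s)}"

text \<open>
  The elements of \<open>X\<close> are measurable functions rather than classes modulo almost
  everywhere equality; by \<open>ideal\<close> membership and quasi-norm only depend on the class.
  In particular, for \<open>M = lebesgue_on Q\<close> only the restriction of a function to
  \<open>Q\<close> matters, so functions on \<open>Q\<close> are represented by functions on the whole space.
  The lattice property also follows from \<open>ideal\<close>, and completeness from \<open>fatou\<close>.
\<close>

locale quasi_banach_function_space =
  fixes M :: "'a measure" and X :: "('a \<Rightarrow> real) set" and nrm :: "('a \<Rightarrow> real) \<Rightarrow> real"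
  assumes measurable: "f \<in> X \<Longrightarrow> f \<in> borel_measurable M"
    and zero: "(\<lambda>x. 0) \<in> X"
    and add: "f \<in> X \<Longrightarrow> g \<in> X \<Longrightarrow> (\<lambda>x. f x + g x) \<in> X"
    and scale: "f \<in> X \<Longrightarrow> (\<lambda>x. r * f x) \<in> X"
    and nrm_nonneg: "f \<in> X \<Longrightarrow> 0 \<le> nrm f"
    and nrm_eq_0: "f \<in> X \<Longrightarrow> nrm f = 0 \<longleftrightarrow> (AE x in M. f x = 0)"
    and nrm_scale: "f \<in> X \<Longrightarrow> nrm (\<lambda>x. r * f x) = \<bar>r\<bar> * nrm f"
    and quasi_triangle: "\<exists>K\<ge>1. \<forall>f\<in>X. \<forall>g\<in>X. nrm (\<lambda>x. f x + g x) \<le> K * (nrm f + nrm g)"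
    and ideal: "f \<in> borel_measurable M \<Longrightarrow> g \<in> X \<Longrightarrow> (AE x in M. \<bar>f x\<bar> \<le> \<bar>g x\<bar>)
                 \<Longrightarrow> f \<in> X \<and> nrm f \<le> nrm g"
    and fatou: "(\<And>j::nat. F j \<in> X) \<Longrightarrow> f \<in> borel_measurable M
                 \<Longrightarrow> (AE x in M. (\<forall>j. 0 \<le> F j x) \<and> incseq (\<lambda>j. F j x) \<and> (\<lambda>j. F j x) \<longlonglongrightarrow> f x)
                 \<Longrightarrow> bdd_above (range (\<lambda>j. nrm (F j)))
                 \<Longrightarrow> f \<in> X \<and> nrm f = (SUP j. nrm (F j))"

text \<open>A family of spaces is given by the carriers \<open>X Q\<close> and the quasi-norms \<open>N Q\<close>.\<close>

type_synonym 'n carriers = "(real ^ 'n) set \<Rightarrow> (real ^ 'n \<Rightarrow> real) set"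
type_synonym 'n qnorms = "(real ^ 'n) set \<Rightarrow> (real ^ 'n \<Rightarrow> real) \<Rightarrow> real"

definition ext_norm ::
    "'n::finite carriers \<Rightarrow> 'n qnorms \<Rightarrow> (real ^ 'n) set \<Rightarrow> (real ^ 'n \<Rightarrow> real) \<Rightarrow> ennreal" where
  "ext_norm X N Q g = (if g \<in> X Q then ennreal (N Q g) else \<infinity>)"

definition normalized_family :: "'n::finite carriers \<Rightarrow> 'n qnorms \<Rightarrow> real \<Rightarrow> real \<Rightarrow> bool" where
  "normalized_family X N c\<^sub>0 C\<^sub>0 \<longleftrightarrow>
     0 < c\<^sub>0 \<and> c\<^sub>0 \<le> C\<^sub>0 \<and>
     (\<forall>Q\<in>cubes. quasi_banach_function_space (lebesgue_on Q) (X Q) (N Q) \<and>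
        ennreal c\<^sub>0 \<le> ext_norm X N Q (indicat_real Q) \<and>
        ext_norm X N Q (indicat_real Q) \<le> ennreal C\<^sub>0)"

definition Lam :: "'n::finite carriers \<Rightarrow> 'n qnorms \<Rightarrow> real \<Rightarrow> ennreal" where
  "Lam X N t =
     (INF Q\<in>cubes. INF E\<in>{E \<in> sets lebesgue. E \<subseteq> Q \<and> t * measure lebesgue Q \<le> measure lebesgue E}.
        ext_norm X N Q (indicat_real E) / ext_norm X N Q (indicat_real Q))"

definition bmo_star_seminorm ::
    "'n::finite carriers \<Rightarrow> 'n qnorms \<Rightarrow> (real ^ 'n \<Rightarrow> real) \<Rightarrow> ennreal" where
  "bmo_star_seminorm X N f =
     (SUP Q\<in>cubes. INF c::real. ext_norm X N Q (\<lambda>x. (f x - c) * indicat_real Q x))"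

definition BMO_star :: "'n::finite carriers \<Rightarrow> 'n qnorms \<Rightarrow> (real ^ 'n \<Rightarrow> real) set" where
  "BMO_star X N = {f \<in> borel_measurable lebesgue. bmo_star_seminorm X N f < \<infinity>}"

definition L1_loc :: "(real ^ 'n \<Rightarrow> real) set" where
  "L1_loc = {f \<in> borel_measurable lebesgue. \<forall>K. compact K \<longrightarrow> set_integrable lebesgue K f}"

definition average :: "(real ^ 'n) set \<Rightarrow> (real ^ 'n \<Rightarrow> real) \<Rightarrow> real" where
  "average Q f = (1 / measure lebesgue Q) * (LINT x:Q|lebesgue. f x)"

text \<open>Only meaningful on \<open>L1_loc\<close>, since the Bochner integral is 0 for non-integrable functions.\<close>

definition bmo_seminorm :: "(real ^ 'n \<Rightarrow> real) \<Rightarrow> ennreal" where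
  "bmo_seminorm f = (SUP Q\<in>cubes. ennreal (average Q (\<lambda>x. \<bar>f x - average Q f\<bar>)))"

definition BMO :: "(real ^ 'n \<Rightarrow> real) set" where
  "BMO = {f \<in> L1_loc. bmo_seminorm f < \<infinity>}"

definition rearrangement :: "(real ^ 'n) set \<Rightarrow> (real ^ 'n \<Rightarrow> real) \<Rightarrow> real \<Rightarrow> ennreal" where
  "rearrangement Q g t =
     (INF \<alpha>\<in>{\<alpha>::real. 0 < \<alpha> \<and> measure lebesgue {x \<in> Q. \<bar>g x\<bar> > \<alpha>} \<le> t}. ennreal \<alpha>)"

definition local_oscillation :: "real \<Rightarrow> (real ^ 'n \<Rightarrow> real) \<Rightarrow> (real ^ 'n) set \<Rightarrow> ennreal" where
  "local_oscillation lam f Q =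
     (INF c::real. rearrangement Q (\<lambda>x. (f x - c) * indicat_real Q x) (lam * measure lebesgue Q))"

definition bmo_sharp_seminorm :: "real \<Rightarrow> (real ^ 'n \<Rightarrow> real) \<Rightarrow> ennreal" where
  "bmo_sharp_seminorm lam f = (SUP Q\<in>cubes. local_oscillation lam f Q)"

definition continuously_embedded ::
    "'f set \<Rightarrow> ('f \<Rightarrow> ennreal) \<Rightarrow> 'f set \<Rightarrow> ('f \<Rightarrow> ennreal) \<Rightarrow> bool" where
  "continuously_embedded A p B q \<longleftrightarrow>
     A \<subseteq> B \<and> (\<exists>K::real. 0 \<le> K \<and> (\<forall>f\<in>A. q f \<le> ennreal K * p f))"

end

theory Submission
  imports Defs
begin

text \<open>
  If a set \<open>E\<close> occupies at least the fraction \<open>lam\<close> of a cube \<open>Q\<close>, then its indicator has quasi-norm at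
  least \<open>c\<^sub>0 * Lam X N lam\<close>. Applied to the level sets of \<open>f - c\<close>, this is a Chebyshev inequality: it
  bounds the local oscillation of \<open>f\<close> on \<open>Q\<close> by the quasi-norm of \<open>f - c\<close> divided by
  \<open>c\<^sub>0 * Lam X N lam\<close>. Taking the infimum over \<open>c\<close> and the supremum over \<open>Q\<close> gives
  \<open>bmo_sharp_le_bmo_star\<close>, and any John--Stroemberg constant turns this into the quantitative estimate.
  
  The embedding itself holds without a given constant, so it rests on the John--Stroemberg theorem
  for every \<open>lam < 1/2\<close>, proved here as \<open>john_stroemberg\<close>. Small local oscillations mean that
  on every cube \<open>f\<close> is within \<open>M\<close> of some constant outside an exceptional set of relative measure
  at most \<open>lam\<close>. A Calderon--Zygmund stopping time at density \<open>1/2\<close> inside the exceptional set of a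
  cube selects disjoint dyadic subcubes of total relative volume at most \<open>2 * lam < 1\<close>, and
  iterating this gives exponential decay of the level sets (\<open>exponential_decay\<close>). The delicate
  point is that the constant of a selected cube stays within a fixed
  multiple of \<open>M\<close> from the constant of the original cube; this is achieved by shrinking the parent of
  the selected cube to it in many small steps (\<open>chain_of_cubes\<close>).
\<close>

section \<open>Half-open cubes and dyadic cells\<close>

text \<open>
  Dyadic subcubes of a closed cube overlap along their faces; half-open cubes are partitioned by
  theirs. They differ from closed cubes by null sets only.
\<close>

definition hcube :: "real ^ 'n \<Rightarrow> real \<Rightarrow> (real ^ 'n) set" where
  "hcube a s = {x. \<forall>i. a $ i \<le> x $ i \<and> x $ i < a $ i + s}"

lemma hcube_subset_cbox: "hcube a s \<subseteq> cbox a (\<chi> i. a $ i + s)"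
  by (auto simp: hcube_def mem_box_cart less_imp_le)

lemma negligible_cbox_minus_hcube:
  "negligible (cbox a (\<chi> i. a $ i + s) - hcube a s)"
proof (rule negligible_subset[OF negligible_frontier_interval])
  show "cbox a (\<chi> i. a $ i + s) - hcube a s \<subseteq> cbox a (\<chi> i. a $ i + s) - box a (\<chi> i. a $ i + s)"
    by (force simp: hcube_def mem_box_cart)
qed

lemma lmeasurable_hcube [simp]: "hcube a s \<in> lmeasurable"
proof -
  have "hcube a s = cbox a (\<chi> i. a $ i + s) - (cbox a (\<chi> i. a $ i + s) - hcube a s)"
    using hcube_subset_cbox[of a s] by blast
  then show ?thesis
    by (metis negligible_cbox_minus_hcube negligible_imp_measurable fmeasurable.Diff lmeasurable_cbox)
qed

lemma sets_hcube [measurable, simp]: "hcube a s \<in> sets lebesgue"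
  by (simp add: fmeasurableD)

lemma measure_cube:
  fixes a :: "real ^ 'n"
  assumes "0 \<le> s"
  shows "measure lebesgue (cbox a (\<chi> i. a $ i + s)) = s ^ CARD('n)"
proof -
  have "cbox a (\<chi> i. a $ i + s) \<noteq> {}"
    using assms by (auto simp: interval_eq_empty_cart not_less)
  then show ?thesis
    by (simp add: content_cbox_cart)
qed

lemma measure_hcube:
  fixes a :: "real ^ 'n"
  assumes "0 \<le> s"
  shows "measure lebesgue (hcube a s) = s ^ CARD('n)"
proof -
  have "negligible (cbox a (\<chi> i. a $ i + s) - hcube a s \<union> (hcube a s - cbox a (\<chi> i. a $ i + s)))"
    using negligible_cbox_minus_hcube[of a s] hcube_subset_cbox[of a s]
    by (metis Diff_eq_empty_iff sup_bot.right_neutral)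
  from measure_negligible_symdiff[OF lmeasurable_cbox this] show ?thesis
    by (simp only: measure_cube[OF assms])
qed

lemma emeasure_hcube:
  fixes a :: "real ^ 'n"
  assumes "0 \<le> s"
  shows "emeasure lebesgue (hcube a s) = ennreal (s ^ CARD('n))"
  by (metis assms emeasure_eq_measure2 lmeasurable_hcube measure_hcube)

text \<open>
  The dyadic cube of generation \<open>k\<close> around \<open>x\<close>, for the grid that has \<open>hcube a s\<close> among its cells of
  generation \<open>0\<close>. As a class of the relation "equal integer parts of the coordinates", the cells
  of one generation form a partition and successive generations are nested without any geometry.
\<close>

definition cell :: "real ^ 'n \<Rightarrow> real \<Rightarrow> nat \<Rightarrow> real ^ 'n \<Rightarrow> (real ^ 'n) set" where
  "cell a s k x = {y. \<forall>i. \<lfloor>2 ^ k * ((y $ i - a $ i) / s)\<rfloor> = \<lfloor>2 ^ k * ((x $ i - a $ i) / s)\<rfloor>}"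

lemma cell_refl [simp]: "x \<in> cell a s k x"
  by (simp add: cell_def)

lemma cell_eq: "y \<in> cell a s k x \<Longrightarrow> cell a s k y = cell a s k x"
  by (simp add: cell_def)

lemma cell_eq_hcube:
  assumes "0 < s"
  obtains b where "cell a s k x = hcube b (s / 2 ^ k)"
proof
  let ?b = "\<chi> i. a $ i + s / 2 ^ k * \<lfloor>2 ^ k * ((x $ i - a $ i) / s)\<rfloor>"
  have "(\<lfloor>2 ^ k * ((u - v) / s)\<rfloor> = z) = (v + s / 2 ^ k * z \<le> u \<and> u < v + s / 2 ^ k * z + s / 2 ^ k)"
    for u v :: real and z :: int
    unfolding floor_eq_iff using assms by (auto simp: field_simps)
  then show "cell a s k x = hcube ?b (s / 2 ^ k)"
    by (auto simp: cell_def hcube_def)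
qed

lemma cell_Suc_subset: "cell a s (Suc k) x \<subseteq> cell a s k x"
proof -
  have "\<lfloor>2 ^ k * t\<rfloor> = \<lfloor>2 ^ Suc k * t\<rfloor> div 2" for t :: real
    using floor_divide_real_eq_div[of 2 "2 ^ Suc k * t"] by (simp add: mult.assoc)
  then show ?thesis
    unfolding cell_def by (auto simp del: power_Suc times_divide_eq_right)
qed

lemma cell_antimono: "j \<le> k \<Longrightarrow> cell a s k x \<subseteq> cell a s j x"
  by (rule lift_Suc_antimono_le[of "\<lambda>k. cell a s k x", OF cell_Suc_subset])

lemma cell_0:
  assumes "0 < s" "x \<in> hcube a s"
  shows "cell a s 0 x = hcube a s"
proof -
  have *: "\<lfloor>(y $ i - a $ i) / s\<rfloor> = 0 \<longleftrightarrow> a $ i \<le> y $ i \<and> y $ i < a $ i + s" for y i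
    unfolding floor_eq_iff using assms by (auto simp: field_simps)
  then have x0: "\<lfloor>(x $ i - a $ i) / s\<rfloor> = 0" for i
    using assms by (auto simp: hcube_def)
  then show ?thesis
    by (simp add: cell_def hcube_def x0 *)
qed

lemma countable_cells:
  fixes a :: "real ^ 'n"
  shows "countable {cell a s k x | k x. True}"
proof -
  have "{cell a s k x | k x. True} \<subseteq>
      range (\<lambda>(k, v :: int ^ 'n). {y. \<forall>i. \<lfloor>2 ^ k * ((y $ i - a $ i) / s)\<rfloor> = v $ i})"
  proof clarify
    fix k x
    have "cell a s k x = (\<lambda>(k, v :: int ^ 'n). {y. \<forall>i. \<lfloor>2 ^ k * ((y $ i - a $ i) / s)\<rfloor> = v $ i})
        (k, \<chi> i. \<lfloor>2 ^ k * ((x $ i - a $ i) / s)\<rfloor>)"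
      by (simp add: cell_def)
    then show "cell a s k x \<in> range (\<lambda>(k, v :: int ^ 'n). {y. \<forall>i. \<lfloor>2 ^ k * ((y $ i - a $ i) / s)\<rfloor> = v $ i})"
      by (rule range_eqI)
  qed
  then show ?thesis
    by (rule countable_subset) simp
qed

lemma small_cell_in_open:
  fixes U :: "(real ^ 'n) set"
  assumes "0 < s" "open U" "x \<in> U"
  shows "\<exists>k. cell a s k x \<subseteq> U"
proof -
  obtain e where e: "0 < e" "ball x e \<subseteq> U"
    using assms openE by blast
  obtain k where k: "CARD('n) * s / e < 2 ^ k"
    using real_arch_pow[of 2 "CARD('n) * s / e"] by auto
  have small: "CARD('n) * (s / 2 ^ k) < e"
    using k e(1) by (simp add: field_simps)
  have "cell a s k x \<subseteq> ball x e"
  proof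
    fix y assume y: "y \<in> cell a s k x"
    obtain b where b: "cell a s k x = hcube b (s / 2 ^ k)"
      using cell_eq_hcube[OF assms(1)] by blast
    have "\<bar>(y - x) $ i\<bar> \<le> s / 2 ^ k" for i
      using y cell_refl[of x a s k] unfolding b hcube_def
      by (smt (verit) mem_Collect_eq vector_minus_component)
    then have "(\<Sum>i\<in>UNIV. \<bar>(y - x) $ i\<bar>) \<le> (\<Sum>i\<in>(UNIV :: 'n set). s / 2 ^ k)"
      by (intro sum_mono) auto
    then have "norm (y - x) \<le> CARD('n) * (s / 2 ^ k)"
      using norm_le_l1_cart[of "y - x"] by simp
    then show "y \<in> ball x e"
      using small by (simp add: dist_norm norm_minus_commute)
  qed
  with e show ?thesis by blast
qed

section \<open>Stopping times on the dyadic grid\<close>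

text \<open>
  The cells at which \<open>P\<close> holds for the first time on the way down are pairwise disjoint: two of them
  with a common point lie on the same descending chain of cells. They cover almost all of \<open>A\<close>, so a
  comparison of \<open>A\<close> with \<open>B\<close> on each of them adds up to a comparison of the two sets. With different
  \<open>P\<close> this is both the decomposition of an open set into maximal dyadic cubes and the
  Calderon--Zygmund decomposition.
\<close>

lemma stopping_time_estimate:
  fixes A B :: "(real ^ 'n) set"
  assumes s: "0 < s"
    and A: "A \<in> sets lebesgue" and B: "B \<in> sets lebesgue"
    and stops: "AE x in lebesgue. x \<in> A \<longrightarrow> (\<exists>k. P (cell a s k x))"
    and est: "\<And>k x. x \<in> A \<Longrightarrow> P (cell a s k x) \<Longrightarrow> (\<And>j. j < k \<Longrightarrow> \<not> P (cell a s j x)) \<Longrightarrow>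
       emeasure lebesgue (A \<inter> cell a s k x) \<le> C * emeasure lebesgue (B \<inter> cell a s k x)"
  shows "emeasure lebesgue A \<le> C * emeasure lebesgue B"
proof -
  define F where "F = {cell a s k x | k x. x \<in> A \<and> P (cell a s k x) \<and> (\<forall>j<k. \<not> P (cell a s j x))}"
  have cnt: "countable F"
    by (rule countable_subset[OF _ countable_cells[of a s]]) (auto simp: F_def)
  have sF [measurable]: "D \<in> sets lebesgue" if "D \<in> F" for D
    using that cell_eq_hcube[OF s] unfolding F_def by (smt (verit) mem_Collect_eq sets_hcube)
  have dis: "disjoint_family_on (\<lambda>D. D) F"
    unfolding disjoint_family_on_def
  proof (intro ballI impI)
    fix D D' assume D: "D \<in> F" "D' \<in> F" and ne: "D \<noteq> D'"
    obtain k x where 1: "D = cell a s k x" "P (cell a s k x)" "\<forall>j<k. \<not> P (cell a s j x)"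
      using D F_def by blast
    obtain l y where 2: "D' = cell a s l y" "P (cell a s l y)" "\<forall>j<l. \<not> P (cell a s j y)"
      using D F_def by blast
    show "D \<inter> D' = {}"
    proof (rule ccontr)
      assume "D \<inter> D' \<noteq> {}"
      then obtain z where z: "z \<in> cell a s k x" "z \<in> cell a s l y"
        using 1 2 by blast
      have zx: "cell a s j z = cell a s j x" if "j \<le> k" for j
        using z(1) cell_antimono[OF that] cell_eq by blast
      have zy: "cell a s j z = cell a s j y" if "j \<le> l" for j
        using z(2) cell_antimono[OF that] cell_eq by blast
      have "k = l"
        using 1 2 zx zy by (metis linorder_neqE_nat less_imp_le_nat order_refl)
      then show False
        using 1 2 zx zy ne by simp
    qed
  qed
  have U [measurable]: "\<Union>F \<in> sets lebesgue"
    using cnt sF by (auto intro: sets.countable_Union)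
  have split: "emeasure lebesgue (S \<inter> \<Union>F) = (\<integral>\<^sup>+D. emeasure lebesgue (S \<inter> D) \<partial>count_space F)"
    if "S \<in> sets lebesgue" for S
  proof -
    have "S \<inter> \<Union>F = \<Union>((\<lambda>D. S \<inter> D) ` F)"
      by blast
    moreover have "disjoint_family_on (\<lambda>D. S \<inter> D) F"
      using dis by (auto simp: disjoint_family_on_def)
    ultimately show ?thesis
      using that cnt emeasure_UN_countable[of F "\<lambda>D. S \<inter> D" lebesgue] by (metis sF sets.Int)
  qed
  have covered: "AE x in lebesgue. x \<in> A \<longrightarrow> x \<in> \<Union>F"
    using stops
  proof eventually_elim
    fix x assume ex: "x \<in> A \<longrightarrow> (\<exists>k. P (cell a s k x))"
    show "x \<in> A \<longrightarrow> x \<in> \<Union>F"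
    proof
      assume "x \<in> A"
      with ex obtain k where "P (cell a s k x)" "\<forall>j<k. \<not> P (cell a s j x)"
        using exists_least_iff[of "\<lambda>k. P (cell a s k x)"] by blast
      with \<open>x \<in> A\<close> have "cell a s k x \<in> F"
        unfolding F_def by blast
      then show "x \<in> \<Union>F"
        using cell_refl by blast
    qed
  qed
  have "emeasure lebesgue A \<le> emeasure lebesgue (A \<inter> \<Union>F)"
    using covered A U by (intro emeasure_mono_AE) auto
  also have "\<dots> = (\<integral>\<^sup>+D. emeasure lebesgue (A \<inter> D) \<partial>count_space F)"
    by (rule split[OF A])
  also have "\<dots> \<le> (\<integral>\<^sup>+D. C * emeasure lebesgue (B \<inter> D) \<partial>count_space F)"
    by (intro nn_integral_mono) (auto simp: F_def intro!: est)
  also have "\<dots> = C * emeasure lebesgue (B \<inter> \<Union>F)"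
    by (simp add: nn_integral_cmult split[OF B])
  also have "\<dots> \<le> C * emeasure lebesgue B"
    by (intro mult_left_mono emeasure_mono) (auto simp: B)
  finally show ?thesis .
qed

lemma emeasure_le_cmult_iff_measure:
  assumes "A \<in> fmeasurable M" "B \<in> fmeasurable M" "0 \<le> C"
  shows "emeasure M A \<le> ennreal C * emeasure M B \<longleftrightarrow> measure M A \<le> C * measure M B"
  using assms by (simp add: emeasure_eq_measure2 flip: ennreal_mult'')

text \<open>
  A weak form of the Lebesgue density theorem, with \<open>1/2\<close> in place of \<open>1\<close>. Let \<open>S\<close> be the set of
  exceptional points. Every cell that meets \<open>S\<close> is filled by \<open>E\<close>, hence by \<open>S\<close>, to at most one half.
  Adding this up over the maximal cells in an open \<open>U\<close> around \<open>S\<close> gives \<open>|S| \<le> |U| / 2\<close>, whereas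
  \<open>U\<close> can be taken with \<open>|U| < 2 |S|\<close> if \<open>|S| > 0\<close>.
\<close>

lemma dyadic_density:
  fixes E :: "(real ^ 'n) set"
  assumes s: "0 < s" and E: "E \<in> lmeasurable"
  shows "AE x in lebesgue. x \<in> E \<longrightarrow>
     (\<exists>k. 1 / 2 * measure lebesgue (cell a s k x) < measure lebesgue (E \<inter> cell a s k x))"
proof -
  define P where "P D \<longleftrightarrow> 1 / 2 * measure lebesgue D < measure lebesgue (E \<inter> D)" for D
  define S where "S = E - \<Union>{D \<in> {cell a s k x | k x. True}. P D}"
  have cells [measurable]: "cell a s k x \<in> lmeasurable" for k x
    using cell_eq_hcube[OF s] by (metis lmeasurable_hcube)
  have "\<Union>{D \<in> {cell a s k x | k x. True}. P D} \<in> sets lebesgue"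
    by (rule sets.countable_Union[OF countable_subset[OF _ countable_cells[of a s]]])
       (auto intro: fmeasurableD[OF cells])
  then have S: "S \<in> lmeasurable"
    unfolding S_def using E by (simp add: fmeasurable_Diff)
  have "measure lebesgue S = 0"
  proof (rule ccontr)
    assume "measure lebesgue S \<noteq> 0"
    then have pos: "0 < measure lebesgue S"
      by (simp add: less_le)
    obtain U where U: "open U" "S \<subseteq> U" "U - S \<in> lmeasurable"
        "emeasure lebesgue (U - S) < ennreal (measure lebesgue S)"
      using sets_lebesgue_outer_open[OF fmeasurableD[OF S] pos] by blast
    have UE: "U = S \<union> (U - S)"
      using U(2) by blast
    have Um: "U \<in> lmeasurable"
      using UE S U(3) by (metis fmeasurable.Un)
    have mU: "measure lebesgue U < 2 * measure lebesgue S"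
    proof -
      have "measure lebesgue (U - S) < measure lebesgue S"
        using U(3,4) by (simp add: emeasure_eq_measure2 ennreal_less_iff)
      moreover have "measure lebesgue U \<le> measure lebesgue S + measure lebesgue (U - S)"
        by (subst UE, rule measure_Un_le) (use S U(3) in \<open>auto intro: fmeasurableD\<close>)
      ultimately show ?thesis by simp
    qed
    have "emeasure lebesgue S \<le> ennreal (1 / 2) * emeasure lebesgue U"
    proof (rule stopping_time_estimate[where P = "\<lambda>D. D \<subseteq> U" and a = a, OF s])
      show "AE x in lebesgue. x \<in> S \<longrightarrow> (\<exists>k. cell a s k x \<subseteq> U)"
        by (rule AE_I2) (use small_cell_in_open[OF s U(1)] U(2) in auto)
    next
      fix k x assume x: "x \<in> S" and sub: "cell a s k x \<subseteq> U"
      have "\<not> P (cell a s k x)"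
        using x cell_refl[of x a s k] unfolding S_def by blast
      then have "measure lebesgue (E \<inter> cell a s k x) \<le> 1 / 2 * measure lebesgue (cell a s k x)"
        by (simp add: P_def)
      moreover have "measure lebesgue (S \<inter> cell a s k x) \<le> measure lebesgue (E \<inter> cell a s k x)"
        by (intro measure_mono_fmeasurable fmeasurable.Int fmeasurableD S E cells) (auto simp: S_def)
      moreover have "U \<inter> cell a s k x = cell a s k x"
        using sub by blast
      ultimately have "measure lebesgue (S \<inter> cell a s k x) \<le> 1 / 2 * measure lebesgue (U \<inter> cell a s k x)"
        by simp
      then show "emeasure lebesgue (S \<inter> cell a s k x) \<le> ennreal (1 / 2) * emeasure lebesgue (U \<inter> cell a s k x)"
        using S Um cells by (subst emeasure_le_cmult_iff_measure) (auto intro: fmeasurable.Int)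
    qed (use S Um in \<open>auto intro: fmeasurableD\<close>)
    then have "measure lebesgue S \<le> 1 / 2 * measure lebesgue U"
      using S Um by (subst (asm) emeasure_le_cmult_iff_measure) auto
    with mU show False by simp
  qed
  then have "S \<in> null_sets lebesgue"
    using S by (metis negligible_iff_measure negligible_iff_null_sets)
  then have "AE x in lebesgue. x \<notin> S"
    by (rule AE_not_in)
  then show ?thesis
  proof eventually_elim
    fix x assume notS: "x \<notin> S"
    show "x \<in> E \<longrightarrow>
        (\<exists>k. 1 / 2 * measure lebesgue (cell a s k x) < measure lebesgue (E \<inter> cell a s k x))"
    proof
      assume "x \<in> E"
      with notS obtain k y where "x \<in> cell a s k y" "P (cell a s k y)"
        unfolding S_def by blast
      then have "P (cell a s k x)"
        by (simp only: cell_eq)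
      then show "\<exists>k. 1 / 2 * measure lebesgue (cell a s k x) < measure lebesgue (E \<inter> cell a s k x)"
        unfolding P_def by blast
    qed
  qed
qed

section \<open>Comparing the constants of nested cubes\<close>

lemma hcube_subset_corners:
  fixes a b :: "real ^ 'n"
  assumes "0 < t" and sub: "hcube b t \<subseteq> hcube a s"
  shows "a $ i \<le> b $ i" "b $ i + t \<le> a $ i + s"
proof -
  have "b \<in> hcube b t"
    using assms(1) by (simp add: hcube_def)
  then have b: "a $ j \<le> b $ j" for j
    using sub by (auto simp: hcube_def)
  show "a $ i \<le> b $ i"
    by (rule b)
  show "b $ i + t \<le> a $ i + s"
  proof (rule ccontr)
    assume out: "\<not> b $ i + t \<le> a $ i + s"
    let ?y = "\<chi> j. if j = i then max (b $ i) (a $ i + s) else b $ j"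
    have "?y \<in> hcube b t"
      using out assms(1) by (auto simp: hcube_def)
    then have "?y \<in> hcube a s"
      using sub by blast
    then have "?y $ i < a $ i + s"
      unfolding hcube_def by blast
    then show False by simp
  qed
qed

lemma hcube_mono:
  "(\<And>i. a $ i \<le> b $ i) \<Longrightarrow> (\<And>i. b $ i + t \<le> a $ i + s) \<Longrightarrow> hcube b t \<subseteq> hcube a s"
  unfolding hcube_def by (auto intro: order_trans less_le_trans)

lemma lmeasurable_superlevel:
  fixes f :: "'a::euclidean_space \<Rightarrow> real"
  assumes f [measurable]: "f \<in> borel_measurable lebesgue" and P: "P \<in> lmeasurable"
  shows "{x \<in> P. M < \<bar>f x - c\<bar>} \<in> lmeasurable"
proof -
  have "{x \<in> space lebesgue. M < \<bar>f x - c\<bar>} \<in> sets lebesgue"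
    by measurable
  then have "P \<inter> {x \<in> space lebesgue. M < \<bar>f x - c\<bar>} \<in> lmeasurable"
    using P by (rule fmeasurable_Int_fmeasurable[rotated])
  moreover have "P \<inter> {x \<in> space lebesgue. M < \<bar>f x - c\<bar>} = {x \<in> P. M < \<bar>f x - c\<bar>}"
    by auto
  ultimately show ?thesis by simp
qed

text \<open>
  Some point of \<open>P\<close> lies in neither exceptional set, and there \<open>f\<close> is within \<open>M\<close> of both constants.
\<close>

lemma close_constants:
  fixes f :: "'a::euclidean_space \<Rightarrow> real"
  assumes f: "f \<in> borel_measurable lebesgue" and P: "P \<in> lmeasurable"
    and small: "measure lebesgue {x \<in> P. M < \<bar>f x - c\<bar>} + measure lebesgue {x \<in> P. M < \<bar>f x - d\<bar>}
      < measure lebesgue P"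
  shows "\<bar>c - d\<bar> \<le> 2 * M"
proof (rule ccontr)
  assume far: "\<not> \<bar>c - d\<bar> \<le> 2 * M"
  have "P \<subseteq> {x \<in> P. M < \<bar>f x - c\<bar>} \<union> {x \<in> P. M < \<bar>f x - d\<bar>}"
  proof
    fix x assume "x \<in> P"
    moreover have "M < \<bar>f x - c\<bar> \<or> M < \<bar>f x - d\<bar>"
      using far by linarith
    ultimately show "x \<in> {x \<in> P. M < \<bar>f x - c\<bar>} \<union> {x \<in> P. M < \<bar>f x - d\<bar>}"
      by blast
  qed
  then have "measure lebesgue P \<le> measure lebesgue ({x \<in> P. M < \<bar>f x - c\<bar>} \<union> {x \<in> P. M < \<bar>f x - d\<bar>})"
    using lmeasurable_superlevel[OF f P] P
    by (intro measure_mono_fmeasurable) (auto simp: fmeasurable.Un intro: fmeasurableD)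
  also have "\<dots> \<le> measure lebesgue {x \<in> P. M < \<bar>f x - c\<bar>} + measure lebesgue {x \<in> P. M < \<bar>f x - d\<bar>}"
    by (intro measure_Un_le fmeasurableD lmeasurable_superlevel[OF f P])
  finally show False
    using small by linarith
qed

text \<open>
  For a cube and a half of it the exceptional sets cannot be compared directly: a set of measure
  \<open>lam * s^n\<close> may contain the whole smaller cube, whose volume is only \<open>(s/2)^n\<close>. Interpolating
  linearly between the two cubes gives \<open>m\<close> steps in each of which the volume shrinks by a factor of
  at most \<open>(1 + 1/m)^n\<close>. As \<open>lam < 1/2\<close>, for large \<open>m\<close> the two exceptional sets of a step together
  do not fill the smaller cube, so the constant moves by at most \<open>2 * M\<close> per step.
\<close>

lemma chain_of_cubes:
  fixes f :: "real ^ 'n \<Rightarrow> real"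
  assumes f: "f \<in> borel_measurable lebesgue"
    and lam: "0 < lam"
    and c: "\<And>a s. 0 < s \<Longrightarrow>
       measure lebesgue {x \<in> hcube a s. M < \<bar>f x - c a s\<bar>} \<le> lam * s ^ CARD('n)"
    and m: "0 < m" "lam * (1 + 1 / real m) ^ CARD('n) + lam < 1"
    and sub: "hcube b t \<subseteq> hcube a s" and t: "0 < t" "t \<le> s" "s \<le> 2 * t"
  shows "\<bar>c a s - c b t\<bar> \<le> 2 * real m * M"
proof -
  define p where "p i = (\<chi> j. a $ j + real i / real m * (b $ j - a $ j))" for i
  define q where "q i = s - real i / real m * (s - t)" for i
  have step: "\<bar>c (p i) (q i) - c (p (Suc i)) (q (Suc i))\<bar> \<le> 2 * M" if i: "i < m" for i
  proof -
    have "real (Suc i) / real m * (s - t) \<le> 1 * (s - t)"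
      using i t by (intro mult_right_mono) (auto simp: field_simps)
    then have qS: "t \<le> q (Suc i)"
      by (simp add: q_def)
    have qdiff: "q i - q (Suc i) = (s - t) / m"
      using m(1) by (simp add: q_def field_simps)
    have "(s - t) / m \<le> q (Suc i) / m"
      using qS t by (intro divide_right_mono) auto
    then have ratio: "q i \<le> (1 + 1 / real m) * q (Suc i)"
      using qdiff by (simp add: algebra_simps)
    have "q (Suc i) \<le> q i"
      using qdiff t by (smt (verit) divide_nonneg_nonneg of_nat_0_le_iff)
    have pdiff: "p (Suc i) $ j - p i $ j = (b $ j - a $ j) / m" for j
      using m(1) by (simp add: p_def field_simps)
    have nested: "hcube (p (Suc i)) (q (Suc i)) \<subseteq> hcube (p i) (q i)"
    proof (rule hcube_mono)
      fix j
      have "0 \<le> (b $ j - a $ j) / m"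
        using hcube_subset_corners(1)[OF t(1) sub, of j] by simp
      then show "p i $ j \<le> p (Suc i) $ j"
        using pdiff[of j] by linarith
      have "(b $ j - a $ j) / m \<le> (s - t) / m"
        using hcube_subset_corners(2)[OF t(1) sub, of j] by (intro divide_right_mono) auto
      then show "p (Suc i) $ j + q (Suc i) \<le> p i $ j + q i"
        using pdiff[of j] qdiff by linarith
    qed
    have pos: "0 < q (Suc i)" "0 < q i"
      using qS t \<open>q (Suc i) \<le> q i\<close> by linarith+
    let ?P = "hcube (p (Suc i)) (q (Suc i))"
    have "measure lebesgue {x \<in> ?P. M < \<bar>f x - c (p i) (q i)\<bar>}
        \<le> measure lebesgue {x \<in> hcube (p i) (q i). M < \<bar>f x - c (p i) (q i)\<bar>}"
      using nested lmeasurable_superlevel[OF f lmeasurable_hcube]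
      by (intro measure_mono_fmeasurable) (auto intro: fmeasurableD)
    also have "\<dots> \<le> lam * q i ^ CARD('n)"
      by (rule c[OF pos(2)])
    also have "\<dots> \<le> lam * ((1 + 1 / real m) * q (Suc i)) ^ CARD('n)"
      using ratio pos lam by (intro mult_left_mono power_mono) auto
    finally have 1: "measure lebesgue {x \<in> ?P. M < \<bar>f x - c (p i) (q i)\<bar>}
        \<le> lam * (1 + 1 / real m) ^ CARD('n) * q (Suc i) ^ CARD('n)"
      by (simp add: power_mult_distrib mult.assoc)
    have 2: "measure lebesgue {x \<in> ?P. M < \<bar>f x - c (p (Suc i)) (q (Suc i))\<bar>} \<le> lam * q (Suc i) ^ CARD('n)"
      by (rule c[OF pos(1)])
    have "(lam * (1 + 1 / real m) ^ CARD('n) + lam) * q (Suc i) ^ CARD('n) < 1 * q (Suc i) ^ CARD('n)"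
      using m(2) pos by (intro mult_strict_right_mono) auto
    then have 3: "lam * (1 + 1 / real m) ^ CARD('n) * q (Suc i) ^ CARD('n) + lam * q (Suc i) ^ CARD('n)
        < measure lebesgue ?P"
      using pos by (simp add: measure_hcube distrib_right)
    show ?thesis
      by (rule close_constants[OF f lmeasurable_hcube[of "p (Suc i)" "q (Suc i)"]]) (use 1 2 3 in linarith)
  qed
  have tele: "\<bar>c (p 0) (q 0) - c (p i) (q i)\<bar> \<le> 2 * real i * M" if "i \<le> m" for i
    using that
  proof (induction i)
    case (Suc i)
    then show ?case
      using step[of i] by (simp add: algebra_simps)
  qed simp
  have "p 0 = a" "q 0 = s" "p m = b" "q m = t"
    using m(1) by (auto simp: p_def q_def vec_eq_iff)
  then show ?thesis
    using tele[of m] by simp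
qed

section \<open>The John--Stroemberg inequality\<close>

text \<open>
  One step of the induction multiplies the measure by \<open>2 * lam < 1\<close>. Let \<open>E\<close> be the exceptional set of
  the cube, of relative measure at most \<open>lam\<close>, and stop at the first cells that \<open>E\<close> fills to more than
  one half. They cover almost all of \<open>E\<close>, and their total volume is at most \<open>2 * |E|\<close>. The parent of a
  stopped cell is still filled by \<open>E\<close> to at most one half, and \<open>1/2 + lam < 1\<close>, so its constant is
  within \<open>2 * M\<close> of that of the original cube; from the parent to the stopped cell the constant moves
  by at most \<open>2 * m * M\<close>. Hence a point of the stopped cell above level \<open>k + 1\<close> for the original cube is
  above level \<open>k\<close> for the stopped cell, where the induction hypothesis applies; the spacing
  \<open>(2 * m + 3) * M\<close> of the levels is at least the total shift \<open>(2 * m + 2) * M\<close>.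
\<close>

lemma exponential_decay:
  fixes f :: "real ^ 'n \<Rightarrow> real"
  assumes f: "f \<in> borel_measurable lebesgue"
    and lam: "0 < lam" "lam < 1 / 2" and M: "0 \<le> M"
    and c: "\<And>a s. 0 < s \<Longrightarrow>
       measure lebesgue {x \<in> hcube a s. M < \<bar>f x - c a s\<bar>} \<le> lam * s ^ CARD('n)"
    and m: "0 < m" "lam * (1 + 1 / real m) ^ CARD('n) + lam < 1"
    and s: "0 < s"
  shows "emeasure lebesgue {x \<in> hcube a s. real k * ((2 * real m + 3) * M) < \<bar>f x - c a s\<bar>}
     \<le> ennreal ((2 * lam) ^ k * s ^ CARD('n))"
  using s
proof (induction k arbitrary: a s)
  case 0
  have "emeasure lebesgue {x \<in> hcube a s. 0 < \<bar>f x - c a s\<bar>} \<le> emeasure lebesgue (hcube a s)"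
    by (intro emeasure_mono) auto
  also have "\<dots> = ennreal (s ^ CARD('n))"
    using 0 by (intro emeasure_hcube) simp
  finally show ?case by simp
next
  case (Suc k)
  note s = \<open>0 < s\<close>
  define L where "L = (2 * real m + 3) * M"
  define A where "A = {x \<in> hcube a s. real (Suc k) * L < \<bar>f x - c a s\<bar>}"
  define E where "E = {x \<in> hcube a s. M < \<bar>f x - c a s\<bar>}"
  define P where "P D \<longleftrightarrow> 1 / 2 * measure lebesgue D < measure lebesgue (E \<inter> D)" for D
  have "M * 1 \<le> M * (real (Suc k) * (2 * real m + 3))"
    using M by (intro mult_left_mono) (auto simp: algebra_simps)
  then have M_le: "M \<le> real (Suc k) * L"
    by (simp add: L_def algebra_simps)
  have A_sub_E: "A \<subseteq> E"
    using M_le by (auto simp: A_def E_def)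
  have mE: "E \<in> lmeasurable" and mA: "A \<in> lmeasurable"
    unfolding A_def E_def by (intro lmeasurable_superlevel[OF f lmeasurable_hcube])+
  have Esmall: "measure lebesgue E \<le> lam * s ^ CARD('n)"
    unfolding E_def by (rule c[OF s])
  have "emeasure lebesgue A \<le> ennreal (2 * (2 * lam) ^ k) * emeasure lebesgue E"
  proof (rule stopping_time_estimate[where P = P and a = a, OF s])
    show "AE x in lebesgue. x \<in> A \<longrightarrow> (\<exists>k. P (cell a s k x))"
      using dyadic_density[OF s mE, of a] A_sub_E unfolding P_def by (auto elim!: eventually_mono)
  next
    fix l x assume x: "x \<in> A" and stop: "P (cell a s l x)" and first: "\<And>j. j < l \<Longrightarrow> \<not> P (cell a s j x)"
    have root: "cell a s 0 x = hcube a s"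
      by (rule cell_0[OF s]) (use x in \<open>simp add: A_def\<close>)
    have "E \<inter> hcube a s = E"
      by (auto simp: E_def)
    moreover have "measure lebesgue E \<le> 1 / 2 * s ^ CARD('n)"
      by (rule order_trans[OF Esmall mult_right_mono]) (use lam s in auto)
    ultimately have "\<not> P (cell a s 0 x)"
      using s root by (simp add: P_def measure_hcube)
    \<comment> \<open>The initial cube is not stopped, so every stopped cell has a parent.\<close>
    with stop obtain j where j: "l = Suc j"
      by (cases l) auto
    define D where "D = cell a s l x"
    define R where "R = cell a s j x"
    define t where "t = s / 2 ^ l"
    obtain b where b: "D = hcube b t"
      using cell_eq_hcube[OF s] unfolding D_def t_def by blast
    obtain b' where b': "R = hcube b' (2 * t)"
      using cell_eq_hcube[OF s, of a j x] unfolding R_def t_def j by auto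
    have t: "0 < t"
      using s by (simp add: t_def)
    have DR: "D \<subseteq> R"
      unfolding D_def R_def j by (rule cell_Suc_subset)
    have child: "\<bar>c b' (2 * t) - c b t\<bar> \<le> 2 * real m * M"
      using DR t unfolding b b' by (intro chain_of_cubes[OF f lam(1) c m]) auto
    have R_eq: "measure lebesgue R = (2 * t) ^ CARD('n)"
      unfolding b' using t by (intro measure_hcube) simp
    have top_parent: "\<bar>c a s - c b' (2 * t)\<bar> \<le> 2 * M"
    proof (rule close_constants[OF f, of R])
      have "R \<subseteq> hcube a s"
        using cell_antimono[of 0 j a s x] root by (simp add: R_def)
      then have "{x \<in> R. M < \<bar>f x - c a s\<bar>} = E \<inter> R"
        by (auto simp: E_def)
      moreover have "measure lebesgue (E \<inter> R) \<le> 1 / 2 * (2 * t) ^ CARD('n)"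
        using first[of j] unfolding P_def R_def[symmetric] R_eq j by simp
      ultimately have "measure lebesgue {x \<in> R. M < \<bar>f x - c a s\<bar>} \<le> 1 / 2 * (2 * t) ^ CARD('n)"
        by (simp only:)
      moreover have "measure lebesgue {x \<in> R. M < \<bar>f x - c b' (2 * t)\<bar>} \<le> lam * (2 * t) ^ CARD('n)"
        unfolding b' using t by (intro c) simp
      moreover have "lam * (2 * t) ^ CARD('n) < 1 / 2 * (2 * t) ^ CARD('n)"
        using lam t by (intro mult_strict_right_mono) auto
      ultimately show "measure lebesgue {x \<in> R. M < \<bar>f x - c a s\<bar>} +
          measure lebesgue {x \<in> R. M < \<bar>f x - c b' (2 * t)\<bar>} < measure lebesgue R"
        unfolding R_eq by linarith
    qed (simp add: b')
    have "A \<inter> D \<subseteq> {x \<in> hcube b t. real k * L < \<bar>f x - c b t\<bar>}"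
    proof
      fix y assume y: "y \<in> A \<inter> D"
      have "real (Suc k) * L = real k * L + 2 * real m * M + 3 * M"
        by (simp add: L_def algebra_simps)
      then have "real k * L < \<bar>f y - c b t\<bar>"
        using y child top_parent M by (auto simp: A_def)
      with y b show "y \<in> {x \<in> hcube b t. real k * L < \<bar>f x - c b t\<bar>}"
        by blast
    qed
    then have "emeasure lebesgue (A \<inter> D) \<le> emeasure lebesgue {x \<in> hcube b t. real k * L < \<bar>f x - c b t\<bar>}"
      by (intro emeasure_mono) (auto intro!: fmeasurableD lmeasurable_superlevel[OF f])
    also have "\<dots> \<le> ennreal ((2 * lam) ^ k * t ^ CARD('n))"
      unfolding L_def by (rule Suc.IH[OF t])
    also have "\<dots> \<le> ennreal ((2 * lam) ^ k * (2 * measure lebesgue (E \<inter> D)))"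
      using stop lam t unfolding P_def D_def[symmetric] b
      by (intro ennreal_leI mult_left_mono) (auto simp: measure_hcube)
    also have "\<dots> = ennreal (2 * (2 * lam) ^ k) * emeasure lebesgue (E \<inter> D)"
      using mE b lam by (simp add: emeasure_eq_measure2 fmeasurable.Int mult_ac flip: ennreal_mult)
    finally show "emeasure lebesgue (A \<inter> cell a s l x)
        \<le> ennreal (2 * (2 * lam) ^ k) * emeasure lebesgue (E \<inter> cell a s l x)"
      unfolding D_def .
  qed (use mA mE in \<open>auto intro: fmeasurableD\<close>)
  also have "\<dots> \<le> ennreal (2 * (2 * lam) ^ k) * ennreal (lam * s ^ CARD('n))"
    using Esmall mE by (intro mult_left_mono) (auto simp: emeasure_eq_measure2 intro: ennreal_leI)
  also have "\<dots> = ennreal ((2 * lam) ^ Suc k * s ^ CARD('n))"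
    using lam s by (simp add: mult_ac flip: ennreal_mult)
  finally show ?case
    by (simp add: A_def L_def)
qed

text \<open>
  The number of \<open>k\<close> with \<open>k * L < y\<close> is the ceiling of \<open>y / L\<close>.
\<close>

lemma le_suminf_of_levels:
  fixes y L :: real
  assumes "0 < L"
  shows "ennreal y \<le> (\<Sum>k. ennreal L * indicator {k. real k * L < y} k)"
proof -
  define n where "n = nat \<lceil>y / L\<rceil>"
  have "y / L \<le> real n"
    by (simp add: n_def real_nat_ceiling_ge)
  then have "y \<le> real n * L"
    using assms by (simp add: pos_divide_le_eq)
  then have "ennreal y \<le> ennreal (\<Sum>k<n. L)"
    by (intro ennreal_leI) simp
  also have "\<dots> = (\<Sum>k<n. ennreal L)"
    using assms by (simp only: sum_ennreal less_imp_le)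
  also have "\<dots> = (\<Sum>k<n. ennreal L * indicator {k. real k * L < y} k)"
  proof (intro sum.cong refl)
    fix k assume "k \<in> {..<n}"
    then have "real k < y / L"
      unfolding n_def by (simp add: zless_nat_eq_int_zless less_ceiling_iff)
    then have "real k * L < y"
      using assms by (simp add: pos_less_divide_eq)
    then show "ennreal L = ennreal L * indicator {k. real k * L < y} k"
      by simp
  qed
  also have "\<dots> \<le> (\<Sum>k. ennreal L * indicator {k. real k * L < y} k)"
    by (rule sum_le_suminf) auto
  finally show ?thesis .
qed

lemma nn_integral_le_suminf_levels:
  fixes g :: "'a::euclidean_space \<Rightarrow> real"
  assumes g [measurable]: "g \<in> borel_measurable lebesgue" and S: "S \<in> lmeasurable" and L: "0 < L"
  shows "(\<integral>\<^sup>+x. ennreal \<bar>g x\<bar> * indicator S x \<partial>lebesgue)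
     \<le> (\<Sum>k. ennreal L * emeasure lebesgue {x \<in> S. real k * L < \<bar>g x\<bar>})"
proof -
  have sets: "{x \<in> S. real k * L < \<bar>g x\<bar>} \<in> sets lebesgue" for k
    using lmeasurable_superlevel[OF g S, of _ 0] by (simp add: fmeasurableD)
  have "(\<integral>\<^sup>+x. ennreal \<bar>g x\<bar> * indicator S x \<partial>lebesgue)
      \<le> (\<integral>\<^sup>+x. (\<Sum>k. ennreal L * indicator {x \<in> S. real k * L < \<bar>g x\<bar>} x) \<partial>lebesgue)"
  proof (rule nn_integral_mono)
    fix x
    show "ennreal \<bar>g x\<bar> * indicator S x \<le> (\<Sum>k. ennreal L * indicator {x \<in> S. real k * L < \<bar>g x\<bar>} x)"
    proof (cases "x \<in> S")
      case True
      then have "indicator {x \<in> S. real k * L < \<bar>g x\<bar>} x = (indicator {k. real k * L < \<bar>g x\<bar>} k :: ennreal)" for k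
        by (simp add: indicator_def)
      then show ?thesis
        using True le_suminf_of_levels[OF L, of "\<bar>g x\<bar>"] by simp
    qed simp
  qed
  also have "\<dots> = (\<Sum>k. ennreal L * emeasure lebesgue {x \<in> S. real k * L < \<bar>g x\<bar>})"
    using sets by (subst nn_integral_suminf) (auto simp: nn_integral_cmult_indicator)
  finally show ?thesis .
qed

lemma exists_chain_length:
  fixes lam :: real
  assumes "lam < 1 / 2"
  shows "\<exists>m>0. lam * (1 + 1 / real m) ^ n + lam < 1"
proof -
  have "(\<lambda>m. lam * (1 + 1 / real m) ^ n + lam) \<longlonglongrightarrow> lam * (1 + 0) ^ n + lam"
    by (intro tendsto_intros lim_1_over_n)
  then have "\<forall>\<^sub>F m in sequentially. lam * (1 + 1 / real m) ^ n + lam < 1"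
    by (rule order_tendstoD(2)) (use assms in simp)
  then have "\<forall>\<^sub>F m in sequentially. 0 < m \<and> lam * (1 + 1 / real m) ^ n + lam < 1"
    using eventually_gt_at_top[of "0 :: nat"] by eventually_elim simp
  then show ?thesis
    by (auto dest: eventually_happens)
qed

lemma cubes_lmeasurable: "Q \<in> cubes \<Longrightarrow> Q \<in> lmeasurable"
  by (auto simp: cubes_def)

lemma measure_cubes_pos:
  assumes "Q \<in> cubes"
  shows "0 < measure lebesgue Q"
proof -
  obtain a s where "0 < s" "Q = cbox a (\<chi> i. a $ i + s)"
    using assms by (auto simp: cubes_def)
  then show ?thesis
    by (simp only: measure_cube less_imp_le zero_less_power)
qed

text \<open>
  The mean of \<open>f\<close> differs from \<open>d\<close> by at most the mean of \<open>|f - d|\<close>.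
\<close>

lemma mean_oscillation_le_twice:
  fixes f :: "real ^ 'n \<Rightarrow> real"
  assumes f: "set_integrable lebesgue Q f" and Q: "Q \<in> cubes"
  shows "average Q (\<lambda>x. \<bar>f x - average Q f\<bar>) \<le> 2 * average Q (\<lambda>x. \<bar>f x - d\<bar>)"
proof -
  define V where "V = measure lebesgue Q"
  define \<mu> where "\<mu> = average Q f"
  have V: "0 < V"
    unfolding V_def by (rule measure_cubes_pos[OF Q])
  have const [simp]: "set_integrable lebesgue Q (\<lambda>x. r)" for r :: real
    using cubes_lmeasurable[OF Q] by (simp add: set_integrable_def lmeasurable_iff_integrable)
  have int_const: "(LINT x:Q|lebesgue. r) = r * V" for r :: real
    by (simp add: set_lebesgue_integral_def V_def)
  have diff: "set_integrable lebesgue Q (\<lambda>x. \<bar>f x - r\<bar>)" for r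
    using f by (intro set_integrable_abs set_integral_diff const)
  define I where "I = (LINT x:Q|lebesgue. \<bar>f x - d\<bar>)"
  have "\<mu> * V - d * V = (LINT x:Q|lebesgue. f x - d)"
    using f V by (simp add: set_integral_diff int_const \<mu>_def average_def V_def)
  also have "\<bar>\<dots>\<bar> \<le> I"
    unfolding I_def set_lebesgue_integral_def
    using integral_abs_bound[of lebesgue "\<lambda>x. indicat_real Q x *\<^sub>R (f x - d)"] by (simp add: abs_mult)
  finally have "\<bar>d - \<mu>\<bar> * V \<le> I"
    using V by (simp add: abs_minus_commute abs_mult flip: left_diff_distrib)
  have "(LINT x:Q|lebesgue. \<bar>f x - \<mu>\<bar>) \<le> (LINT x:Q|lebesgue. \<bar>f x - d\<bar> + \<bar>d - \<mu>\<bar>)"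
    by (intro set_integral_mono diff set_integral_add const) auto
  also have "\<dots> = I + \<bar>d - \<mu>\<bar> * V"
    using diff by (simp add: set_integral_add int_const I_def)
  also have "\<dots> \<le> 2 * I"
    using \<open>\<bar>d - \<mu>\<bar> * V \<le> I\<close> by simp
  finally show ?thesis
    unfolding \<mu>_def[symmetric] unfolding average_def I_def V_def[symmetric]
    using V by (simp add: field_simps)
qed

text \<open>
  Summing the exponentially decaying measures of the level sets over the levels gives a bound for the
  mean of \<open>|f - c|\<close>.
\<close>

lemma mean_oscillation_bound:
  fixes f :: "real ^ 'n \<Rightarrow> real"
  assumes f: "f \<in> L1_loc"
    and lam: "0 < lam" "lam < 1 / 2" and M: "0 < M"
    and osc: "\<And>Q. Q \<in> cubes \<Longrightarrow> \<exists>c. measure lebesgue {x \<in> Q. M < \<bar>f x - c\<bar>} \<le> lam * measure lebesgue Q"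
    and m: "0 < m" "lam * (1 + 1 / real m) ^ CARD('n) + lam < 1"
    and Q: "Q \<in> cubes"
  shows "average Q (\<lambda>x. \<bar>f x - average Q f\<bar>) \<le> 2 * (2 * real m + 3) / (1 - 2 * lam) * M"
proof -
  have fm: "f \<in> borel_measurable lebesgue"
    using f by (simp add: L1_loc_def)
  have ex: "\<exists>c. measure lebesgue {x \<in> hcube a s. M < \<bar>f x - c\<bar>} \<le> lam * s ^ CARD('n)" if s: "0 < s"
    for a :: "real ^ 'n" and s
  proof -
    have "cbox a (\<chi> i. a $ i + s) \<in> cubes"
      unfolding cubes_def using s by blast
    from osc[OF this] obtain c where
      c: "measure lebesgue {x \<in> cbox a (\<chi> i. a $ i + s). M < \<bar>f x - c\<bar>} \<le> lam * s ^ CARD('n)"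
      unfolding measure_cube[OF less_imp_le[OF s]] by blast
    have "measure lebesgue {x \<in> hcube a s. M < \<bar>f x - c\<bar>}
        \<le> measure lebesgue {x \<in> cbox a (\<chi> i. a $ i + s). M < \<bar>f x - c\<bar>}"
      using hcube_subset_cbox[of a s]
      by (intro measure_mono_fmeasurable fmeasurableD lmeasurable_superlevel[OF fm]) auto
    from this c have "measure lebesgue {x \<in> hcube a s. M < \<bar>f x - c\<bar>} \<le> lam * s ^ CARD('n)"
      by (rule order_trans)
    then show ?thesis ..
  qed
  define c where
    "c a s = (SOME c. measure lebesgue {x \<in> hcube a s. M < \<bar>f x - c\<bar>} \<le> lam * s ^ CARD('n))" for a s
  have c: "measure lebesgue {x \<in> hcube a s. M < \<bar>f x - c a s\<bar>} \<le> lam * s ^ CARD('n)" if "0 < s" for a s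
    unfolding c_def by (rule someI_ex[OF ex[OF that]])
  obtain a s where s: "0 < s" and Qas: "Q = cbox a (\<chi> i. a $ i + s)"
    using Q by (auto simp: cubes_def)
  define L where "L = (2 * real m + 3) * M"
  have L: "0 < L"
    using M by (simp add: L_def add_nonneg_pos)
  define g where "g = (\<lambda>x. f x - c a s)"
  have gm [measurable]: "g \<in> borel_measurable lebesgue"
    unfolding g_def using fm by measurable
  have "(\<lambda>k. (2 * lam) ^ k) sums (1 / (1 - 2 * lam))"
    using lam by (intro geometric_sums) auto
  from sums_mult[OF this, of "L * s ^ CARD('n)"]
  have series: "(\<lambda>k. L * ((2 * lam) ^ k * s ^ CARD('n))) sums (L / (1 - 2 * lam) * s ^ CARD('n))"
    by (simp add: mult_ac)
  have "AE x in lebesgue. x \<notin> Q - hcube a s"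
    unfolding Qas
    by (intro AE_not_in) (metis negligible_cbox_minus_hcube negligible_iff_null_sets)
  then have "(\<integral>\<^sup>+x. ennreal (indicator Q x *\<^sub>R \<bar>g x\<bar>) \<partial>lebesgue)
      \<le> (\<integral>\<^sup>+x. ennreal \<bar>g x\<bar> * indicator (hcube a s) x \<partial>lebesgue)"
    by (intro nn_integral_mono_AE) (auto elim!: eventually_mono simp: indicator_def)
  also have "\<dots> \<le> (\<Sum>k. ennreal L * emeasure lebesgue {x \<in> hcube a s. real k * L < \<bar>g x\<bar>})"
    by (rule nn_integral_le_suminf_levels[OF gm lmeasurable_hcube L])
  also have "\<dots> \<le> (\<Sum>k. ennreal L * ennreal ((2 * lam) ^ k * s ^ CARD('n)))"
    unfolding g_def L_def
    by (intro suminf_le mult_left_mono exponential_decay[OF fm lam _ c m s] summableI) (use M in auto)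
  also have "\<dots> = (\<Sum>k. ennreal (L * ((2 * lam) ^ k * s ^ CARD('n))))"
    using L lam s by (simp flip: ennreal_mult)
  also have "\<dots> = ennreal (L / (1 - 2 * lam) * s ^ CARD('n))"
    by (rule suminf_ennreal_eq[OF _ series]) (use L lam s in auto)
  finally have "(LINT x:Q|lebesgue. \<bar>g x\<bar>) \<le> L / (1 - 2 * lam) * s ^ CARD('n)"
    unfolding set_lebesgue_integral_def
    by (intro integral_real_bounded) (use L lam s in auto)
  then have "average Q (\<lambda>x. \<bar>g x\<bar>) \<le> L / (1 - 2 * lam)"
    using s unfolding average_def Qas measure_cube[OF less_imp_le[OF s]]
    by (simp add: pos_divide_le_eq)
  moreover have "set_integrable lebesgue Q f"
    using f unfolding Qas L1_loc_def by (auto simp: compact_cbox)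
  from mean_oscillation_le_twice[OF this Q, of "c a s"]
  have "average Q (\<lambda>x. \<bar>f x - average Q f\<bar>) \<le> 2 * average Q (\<lambda>x. \<bar>g x\<bar>)"
    by (simp add: g_def)
  ultimately have "average Q (\<lambda>x. \<bar>f x - average Q f\<bar>) \<le> 2 * (L / (1 - 2 * lam))"
    by linarith
  then show ?thesis
    unfolding L_def by (simp only: times_divide_eq_left times_divide_eq_right mult.assoc)
qed

text \<open>
  Since the local oscillation is an infimum, the constants \<open>c\<close> exist only for \<open>M\<close> strictly above the
  seminorm; the bound is linear in \<open>M\<close>, so letting \<open>M\<close> tend to the seminorm gives the claim, including
  the case of seminorm \<open>0\<close>.
\<close>

theorem john_stroemberg:
  assumes lam: "0 < lam" "lam < 1 / 2"
  shows "\<exists>K>0. \<forall>f::real ^ 'n \<Rightarrow> real. f \<in> L1_loc \<longrightarrow>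
     bmo_seminorm f \<le> ennreal K * bmo_sharp_seminorm lam f"
proof -
  obtain m where m: "0 < m" "lam * (1 + 1 / real m) ^ CARD('n) + lam < 1"
    using exists_chain_length[OF lam(2)] by blast
  define K where "K = 2 * (2 * real m + 3) / (1 - 2 * lam)"
  have K: "0 < K"
    using lam by (simp add: K_def add_nonneg_pos)
  have "bmo_seminorm f \<le> ennreal K * bmo_sharp_seminorm lam f" if f: "f \<in> L1_loc"
    for f :: "real ^ 'n \<Rightarrow> real"
  proof (cases "bmo_sharp_seminorm lam f" rule: ennreal_cases)
    case top
    then show ?thesis
      using K by (simp add: ennreal_mult_top)
  next
    case (real \<sigma>)
    have fm: "f \<in> borel_measurable lebesgue"
      using f by (simp add: L1_loc_def)
    have osc: "\<exists>c. measure lebesgue {x \<in> Q. M < \<bar>f x - c\<bar>} \<le> lam * measure lebesgue Q"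
      if Q: "Q \<in> cubes" and M: "\<sigma> < M" for Q M
    proof -
      have "local_oscillation lam f Q \<le> ennreal \<sigma>"
        unfolding real(2)[symmetric] bmo_sharp_seminorm_def using Q by (rule SUP_upper)
      also have "\<dots> < ennreal M"
        using M real by (simp add: ennreal_less_iff)
      finally obtain c \<alpha> where \<alpha>: "0 < \<alpha>" "ennreal \<alpha> < ennreal M"
        "measure lebesgue {x \<in> Q. \<alpha> < \<bar>(f x - c) * indicat_real Q x\<bar>} \<le> lam * measure lebesgue Q"
        unfolding local_oscillation_def rearrangement_def INF_less_iff by blast
      have "\<alpha> < M"
        using \<alpha>(1,2) by (simp add: ennreal_less_iff)
      have "{x \<in> Q. \<alpha> < \<bar>(f x - c) * indicat_real Q x\<bar>} = {x \<in> Q. \<alpha> < \<bar>f x - c\<bar>}"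
        by auto
      moreover have "measure lebesgue {x \<in> Q. M < \<bar>f x - c\<bar>} \<le> measure lebesgue {x \<in> Q. \<alpha> < \<bar>f x - c\<bar>}"
        using \<open>\<alpha> < M\<close> cubes_lmeasurable[OF Q]
        by (intro measure_mono_fmeasurable fmeasurableD lmeasurable_superlevel[OF fm]) auto
      ultimately have "measure lebesgue {x \<in> Q. M < \<bar>f x - c\<bar>} \<le> lam * measure lebesgue Q"
        using \<alpha>(3) by simp
      then show ?thesis ..
    qed
    have "average Q (\<lambda>x. \<bar>f x - average Q f\<bar>) \<le> K * \<sigma>" if Q: "Q \<in> cubes" for Q
    proof (rule field_le_epsilon)
      fix e :: real assume "0 < e"
      then have larger: "\<sigma> < \<sigma> + e / K"
        using K by simp
      then have pos: "0 < \<sigma> + e / K"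
        using real(1) by simp
      have "average Q (\<lambda>x. \<bar>f x - average Q f\<bar>) \<le> K * (\<sigma> + e / K)"
        using mean_oscillation_bound[OF f lam pos osc[OF _ larger] m Q] by (simp only: K_def)
      then show "average Q (\<lambda>x. \<bar>f x - average Q f\<bar>) \<le> K * \<sigma> + e"
        using K by (simp add: distrib_left)
    qed
    then have "bmo_seminorm f \<le> ennreal (K * \<sigma>)"
      unfolding bmo_seminorm_def by (intro SUP_least ennreal_leI)
    then show ?thesis
      using K real by (simp add: ennreal_mult)
  qed
  with K show ?thesis by blast
qed

section \<open>From the quasi-norms to local oscillations\<close>

lemma indicator_norm_lower_bound:
  fixes X :: "(real ^ 'n) set \<Rightarrow> (real ^ 'n \<Rightarrow> real) set"
  assumes X: "normalized_family X N c\<^sub>0 C\<^sub>0" and Q: "Q \<in> cubes"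
    and E: "E \<in> sets lebesgue" "E \<subseteq> Q" "t * measure lebesgue Q \<le> measure lebesgue E"
  shows "indicat_real E \<in> X Q" "ennreal c\<^sub>0 * Lam X N t \<le> ennreal (N Q (indicat_real E))"
proof -
  interpret quasi_banach_function_space "lebesgue_on Q" "X Q" "N Q"
    using X Q by (simp add: normalized_family_def)
  have c: "0 < c\<^sub>0"
    and low: "ennreal c\<^sub>0 \<le> ext_norm X N Q (indicat_real Q)"
    and up: "ext_norm X N Q (indicat_real Q) \<le> ennreal C\<^sub>0"
    using X Q by (auto simp: normalized_family_def)
  have QX: "indicat_real Q \<in> X Q"
    using up by (auto simp: ext_norm_def top_unique split: if_splits)
  have "indicat_real E \<in> borel_measurable (lebesgue_on Q)"
    using E(1) by (intro measurable_restrict_space1) simp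
  then show EX: "indicat_real E \<in> X Q"
    using E(2) by (intro conjunct1[OF ideal[OF _ QX]] AE_I2) (auto simp: indicator_def)
  have Q0: "ext_norm X N Q (indicat_real Q) \<noteq> 0"
    using low c by (metis ennreal_eq_0_iff le_zero_eq not_le)
  have Qtop: "ext_norm X N Q (indicat_real Q) \<noteq> top"
    using up by (metis ennreal_neq_top top_unique)
  have "Lam X N t \<le> ext_norm X N Q (indicat_real E) / ext_norm X N Q (indicat_real Q)"
    unfolding Lam_def using Q E by (intro INF_lower2[OF Q] INF_lower) auto
  then have "ext_norm X N Q (indicat_real Q) * Lam X N t
      \<le> ext_norm X N Q (indicat_real Q) * (ext_norm X N Q (indicat_real E) / ext_norm X N Q (indicat_real Q))"
    by (rule mult_left_mono) simp
  also have "\<dots> = ext_norm X N Q (indicat_real E)"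
    using Q0 Qtop by (simp add: ennreal_times_divide mult.commute mult_divide_eq_ennreal)
  finally have "ext_norm X N Q (indicat_real Q) * Lam X N t \<le> ennreal (N Q (indicat_real E))"
    using EX by (simp add: ext_norm_def)
  with mult_right_mono[OF low, of "Lam X N t"]
  show "ennreal c\<^sub>0 * Lam X N t \<le> ennreal (N Q (indicat_real E))"
    by (metis order_trans zero_le)
qed

text \<open>
  Finiteness lets one cancel \<open>Lam X N t\<close>: in \<open>ennreal\<close> division by \<open>\<infinity>\<close> gives \<open>0\<close>.
\<close>

lemma Lam_finite:
  fixes X :: "(real ^ 'n) set \<Rightarrow> (real ^ 'n \<Rightarrow> real) set"
  assumes X: "normalized_family X N c\<^sub>0 C\<^sub>0" and t: "t \<le> 1"
  shows "Lam X N t \<noteq> top"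
proof -
  have Q: "cbox (0 :: real ^ 'n) (\<chi> i. (0 :: real ^ 'n) $ i + 1) \<in> cubes" (is "?Q \<in> _")
    unfolding cubes_def by (intro CollectI exI[of _ 0] exI[of _ "1 :: real"]) simp
  have "ennreal c\<^sub>0 * Lam X N t \<le> ennreal (N ?Q (indicat_real ?Q))"
    by (rule indicator_norm_lower_bound(2)[OF X Q])
       (use cubes_lmeasurable[OF Q] measure_cubes_pos[OF Q] t in \<open>auto intro: fmeasurableD mult_left_le_one_le\<close>)
  moreover have "0 < c\<^sub>0"
    using X by (simp add: normalized_family_def)
  ultimately show ?thesis
    by (auto simp: ennreal_mult_top top_unique)
qed

text \<open>
  This is Chebyshev's inequality for the quasi-norms. If \<open>\<alpha>\<close> is below the rearrangement of \<open>f - c\<close> at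
  \<open>lam * |Q|\<close>, then \<open>E = {|f - c| > \<alpha>}\<close> occupies at least the fraction \<open>lam\<close> of \<open>Q\<close>. Its indicator
  has quasi-norm at least \<open>\<kappa> = c\<^sub>0 * Lam X N lam\<close>, and \<open>\<alpha> * \<chi>\<^sub>E \<le> |f - c|\<close>, so the quasi-norm of
  \<open>f - c\<close> on \<open>Q\<close> is at least \<open>\<alpha> * \<kappa>\<close>.
\<close>

lemma bmo_sharp_le_bmo_star:
  fixes X :: "(real ^ 'n) set \<Rightarrow> (real ^ 'n \<Rightarrow> real) set"
  assumes X: "normalized_family X N c\<^sub>0 C\<^sub>0" and lam: "lam \<le> 1"
    and \<Lambda>: "0 < Lam X N lam"
    and f: "f \<in> borel_measurable lebesgue"
  shows "bmo_sharp_seminorm lam f \<le> bmo_star_seminorm X N f / (ennreal c\<^sub>0 * Lam X N lam)"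
proof -
  define \<kappa> where "\<kappa> = ennreal c\<^sub>0 * Lam X N lam"
  have "0 < c\<^sub>0"
    using X by (simp add: normalized_family_def)
  then have \<kappa>: "\<kappa> \<noteq> 0" "\<kappa> \<noteq> top"
    using \<Lambda> Lam_finite[OF X lam] by (auto simp: \<kappa>_def ennreal_mult_eq_top_iff)
  have chebyshev: "rearrangement Q (\<lambda>x. (f x - c) * indicat_real Q x) (lam * measure lebesgue Q)
      \<le> ext_norm X N Q (\<lambda>x. (f x - c) * indicat_real Q x) / \<kappa>" (is "?R \<le> ext_norm X N Q ?g / \<kappa>")
    if Q: "Q \<in> cubes" for Q c
  proof (cases "?g \<in> X Q")
    case False
    then show ?thesis
      using \<kappa> by (simp add: ext_norm_def ennreal_top_divide)
  next
    case True
    interpret quasi_banach_function_space "lebesgue_on Q" "X Q" "N Q"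
      using X Q by (simp add: normalized_family_def)
    show ?thesis
    proof (rule dense_le)
      fix y assume y: "y < ?R"
      then obtain \<alpha> where \<alpha>: "y = ennreal \<alpha>" "0 \<le> \<alpha>"
        by (cases y rule: ennreal_cases) auto
      show "y \<le> ext_norm X N Q ?g / \<kappa>"
      proof (cases "\<alpha> = 0")
        case False
        then have pos: "0 < \<alpha>"
          using \<alpha> by simp
        define E where "E = {x \<in> Q. \<alpha> < \<bar>f x - c\<bar>}"
        have E_eq: "{x \<in> Q. \<alpha> < \<bar>?g x\<bar>} = E"
          by (auto simp: E_def)
        have large: "lam * measure lebesgue Q \<le> measure lebesgue E"
        proof (rule ccontr)
          assume "\<not> lam * measure lebesgue Q \<le> measure lebesgue E"
          then have "?R \<le> ennreal \<alpha>"
            unfolding rearrangement_def using pos E_eq by (intro INF_lower) auto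
          with y \<alpha> show False by simp
        qed
        have Em: "E \<in> sets lebesgue"
          unfolding E_def by (intro fmeasurableD lmeasurable_superlevel[OF f] cubes_lmeasurable[OF Q])
        have E: "indicat_real E \<in> X Q" "\<kappa> \<le> ennreal (N Q (indicat_real E))"
          unfolding \<kappa>_def
          by (rule indicator_norm_lower_bound[OF X Q Em _ large]; simp add: E_def)+
        have "ennreal \<alpha> * \<kappa> \<le> ennreal \<alpha> * ennreal (N Q (indicat_real E))"
          by (intro mult_left_mono E(2)) simp
        also have "\<dots> = ennreal (N Q (\<lambda>x. \<alpha> * indicat_real E x))"
          using nrm_scale[OF E(1), of \<alpha>] nrm_nonneg[OF E(1)] \<alpha> by (simp add: ennreal_mult)
        also have "\<dots> \<le> ennreal (N Q ?g)"
          using pos ideal[OF measurable[OF scale[OF E(1), of \<alpha>]] True]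
          by (intro ennreal_leI) (auto simp: E_def indicator_def)
        also have "\<dots> = ext_norm X N Q ?g"
          using True by (simp add: ext_norm_def)
        finally have "(ennreal \<alpha> * \<kappa>) / \<kappa> \<le> ext_norm X N Q ?g / \<kappa>"
          by (rule divide_right_mono_ennreal)
        then show ?thesis
          using \<kappa> \<alpha> by (simp add: mult_divide_eq_ennreal)
      qed (simp add: \<alpha>)
    qed
  qed
  have "local_oscillation lam f Q \<le> bmo_star_seminorm X N f / \<kappa>" if Q: "Q \<in> cubes" for Q
  proof -
    have "local_oscillation lam f Q * \<kappa> \<le> (INF c. ext_norm X N Q (\<lambda>x. (f x - c) * indicat_real Q x))"
    proof (rule INF_greatest)
      fix c
      have "local_oscillation lam f Q \<le> rearrangement Q (\<lambda>x. (f x - c) * indicat_real Q x) (lam * measure lebesgue Q)"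
        unfolding local_oscillation_def by (rule INF_lower) simp
      also note chebyshev[OF Q]
      finally have "local_oscillation lam f Q * \<kappa> \<le> ext_norm X N Q (\<lambda>x. (f x - c) * indicat_real Q x) / \<kappa> * \<kappa>"
        by (rule mult_right_mono) simp
      then show "local_oscillation lam f Q * \<kappa> \<le> ext_norm X N Q (\<lambda>x. (f x - c) * indicat_real Q x)"
        using \<kappa> by (simp add: ennreal_divide_times ennreal_divide_self top.not_eq_extremum)
    qed
    also have "\<dots> \<le> bmo_star_seminorm X N f"
      unfolding bmo_star_seminorm_def using Q by (rule SUP_upper)
    finally have "local_oscillation lam f Q * \<kappa> / \<kappa> \<le> bmo_star_seminorm X N f / \<kappa>"
      by (rule divide_right_mono_ennreal)
    then show ?thesis
      using \<kappa> by (simp add: mult_divide_eq_ennreal)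
  qed
  then show ?thesis
    unfolding bmo_sharp_seminorm_def \<kappa>_def by (rule SUP_least)
qed

section \<open>The embedding\<close>

theorem theorem3p5:
  fixes X :: "(real ^ 'n) set \<Rightarrow> (real ^ 'n \<Rightarrow> real) set"
    and N :: "(real ^ 'n) set \<Rightarrow> (real ^ 'n \<Rightarrow> real) \<Rightarrow> real"
    and c\<^sub>0 C\<^sub>0 lam :: real
  assumes "normalized_family X N c\<^sub>0 C\<^sub>0"
    and "0 < lam" and "lam < 1 / 2"
    and "Lam X N lam > 0"
  shows "continuously_embedded (BMO_star X N \<inter> L1_loc) (bmo_star_seminorm X N) BMO bmo_seminorm
    \<and> (\<forall>C::real. C > 0 \<and>
          (\<forall>f::real ^ 'n \<Rightarrow> real. f \<in> L1_loc \<longrightarrow>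
              bmo_seminorm f \<le> ennreal C * bmo_sharp_seminorm lam f) \<longrightarrow>
        (\<forall>f\<in>BMO_star X N \<inter> L1_loc.
            bmo_seminorm f \<le> ennreal C / (ennreal c\<^sub>0 * Lam X N lam) * bmo_star_seminorm X N f))"
proof -
  let ?\<kappa> = "ennreal c\<^sub>0 * Lam X N lam"
  have quantitative: "bmo_seminorm f \<le> ennreal C / ?\<kappa> * bmo_star_seminorm X N f"
    if C: "\<forall>f::real ^ 'n \<Rightarrow> real. f \<in> L1_loc \<longrightarrow> bmo_seminorm f \<le> ennreal C * bmo_sharp_seminorm lam f"
      and f: "f \<in> L1_loc" for C f
  proof -
    have "bmo_seminorm f \<le> ennreal C * bmo_sharp_seminorm lam f"
      using C f by blast
    also have "\<dots> \<le> ennreal C * (bmo_star_seminorm X N f / ?\<kappa>)"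
      using assms f by (intro mult_left_mono bmo_sharp_le_bmo_star[OF assms(1)]) (auto simp: L1_loc_def)
    also have "\<dots> = ennreal C / ?\<kappa> * bmo_star_seminorm X N f"
      by (simp only: ennreal_divide_times)
    finally show ?thesis .
  qed
  obtain K where K: "0 < K"
    "\<forall>f::real ^ 'n \<Rightarrow> real. f \<in> L1_loc \<longrightarrow> bmo_seminorm f \<le> ennreal K * bmo_sharp_seminorm lam f"
    using john_stroemberg[OF assms(2,3)] by blast
  have "?\<kappa> \<noteq> 0"
    using assms by (auto simp: normalized_family_def)
  then have "ennreal K / ?\<kappa> \<noteq> top"
    by (simp add: ennreal_divide_eq_top_iff)
  then obtain r where r: "ennreal K / ?\<kappa> = ennreal r" "0 \<le> r"
    by (cases "ennreal K / ?\<kappa>" rule: ennreal_cases) auto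
  have bound: "bmo_seminorm f \<le> ennreal r * bmo_star_seminorm X N f" if "f \<in> BMO_star X N \<inter> L1_loc" for f
    using quantitative[OF K(2), of f] that r by simp
  have "BMO_star X N \<inter> L1_loc \<subseteq> BMO"
  proof
    fix f assume f: "f \<in> BMO_star X N \<inter> L1_loc"
    then have "ennreal r * bmo_star_seminorm X N f < top"
      by (simp add: BMO_star_def ennreal_mult_less_top)
    with bound[OF f] f show "f \<in> BMO"
      by (auto simp: BMO_def intro: le_less_trans)
  qed
  then have "continuously_embedded (BMO_star X N \<inter> L1_loc) (bmo_star_seminorm X N) BMO bmo_seminorm"
    unfolding continuously_embedded_def using bound r(2) by blast
  with quantitative show ?thesis by blast
qed

end
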